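(* Let $G$ be a 2-connected graph. Then for every positive integer $k$ there is a protocol solving the multiparty equality problem on $G$ with $k$-bit inputs in the local broadcast model, in which only the vertices of a fixed minimum total vertex cover of $G$ send messages, and whose total cost is at most $\left(\tfrac{k}{2}+o(k)\right)\mathsf{tvc}(G)$, where $o(k)$ is taken as $k\to\infty$ with $G$ fixed. In particular $\mathrm{opt}(G)\le \tfrac12\,\mathsf{tvc}(G)$.
   Context: Multiparty equality in the local broadcast model: $G$ is a connected graph and $k$ a positive integer; every vertex $v$ receives an input $\lambda(v)\in\{0,1\}^k$. Vertices communicate (possibly over several rounds) by broadcasting messages; a message broadcast by a vertex is received by all of its neighbours, and its number of bits is counted once. Protocols are deterministic and static: which vertices send messages, and the lengths of the messages, depend only on $G$ and $k$, while the contents of messages may depend on the inputs (and on previously received messages). At the end, every vertex accepts or rejects. The protocol solves the problem if, whenever all inputs are equal, every vertex accepts, and whenever two inputs differ, at least one vertex rejects. The total cost of a protocol is the sum over all vertices of the number of bits they broadcast. $\mathrm{opt}(G,k)$ is the minimum total cost of a protocol solving the problem, and $\mathrm{opt}(G)=\lim_{k\to\infty}\mathrm{opt}(G,k)/k$ (this limit exists). A total vertex cover of $G$ is a set $S\subseteq V(G)$ that is a vertex cover (every edge has an endpoint in $S$) and a total dominating set (every vertex of $G$, including those in $S$, has a neighbour in $S$); $\mathsf{tvc}(G)$ is the minimum size of a total vertex cover. *)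

theory Defs
  imports Complex_Main "HOL-Library.Landau_Symbols" "HOL-Library.Liminf_Limsup" "HOL-Library.Extended_Real"
begin

definition graph :: "'a set \<Rightarrow> ('a \<Rightarrow> 'a \<Rightarrow> bool) \<Rightarrow> bool" where
  "graph V E \<longleftrightarrow> finite V \<and>
     (\<forall>u v. E u v \<longrightarrow> u \<in> V \<and> v \<in> V \<and> u \<noteq> v \<and> E v u)"

definition connected_on :: "'a set \<Rightarrow> ('a \<Rightarrow> 'a \<Rightarrow> bool) \<Rightarrow> bool" where
  "connected_on W E \<longleftrightarrow>
     (\<forall>u\<in>W. \<forall>v\<in>W. (\<lambda>a b. E a b \<and> a \<in> W \<and> b \<in> W)\<^sup>*\<^sup>* u v)"

definition two_connected :: "'a set \<Rightarrow> ('a \<Rightarrow> 'a \<Rightarrow> bool) \<Rightarrow> bool" where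
  "two_connected V E \<longleftrightarrow> graph V E \<and> card V \<ge> 3 \<and> connected_on V E \<and>
     (\<forall>x\<in>V. connected_on (V - {x}) E)"

definition is_tvc :: "'a set \<Rightarrow> ('a \<Rightarrow> 'a \<Rightarrow> bool) \<Rightarrow> 'a set \<Rightarrow> bool" where
  "is_tvc V E S \<longleftrightarrow> S \<subseteq> V \<and> (\<forall>u v. E u v \<longrightarrow> u \<in> S \<or> v \<in> S) \<and>
     (\<forall>v\<in>V. \<exists>u\<in>S. E v u)"

definition tvc :: "'a set \<Rightarrow> ('a \<Rightarrow> 'a \<Rightarrow> bool) \<Rightarrow> nat" where
  "tvc V E = (LEAST n. \<exists>S. is_tvc V E S \<and> card S = n)"

definition is_min_tvc :: "'a set \<Rightarrow> ('a \<Rightarrow> 'a \<Rightarrow> bool) \<Rightarrow> 'a set \<Rightarrow> bool" where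
  "is_min_tvc V E S \<longleftrightarrow> is_tvc V E S \<and> card S = tvc V E"

text \<open>A protocol runs for rounds 0..rounds-1. In round r vertex u broadcasts a message of
  length len r u (depending only on the graph and k). Its content msg r u b h may depend on
  the vertex's input b and its view h, where h s w is the message received from neighbour w
  in an earlier round s (and [] otherwise). At the end vertex v accepts iff dec v b h.\<close>
record 'a protocol =
  rounds :: nat
  len :: "nat \<Rightarrow> 'a \<Rightarrow> nat"
  msg :: "nat \<Rightarrow> 'a \<Rightarrow> bool list \<Rightarrow> (nat \<Rightarrow> 'a \<Rightarrow> bool list) \<Rightarrow> bool list"
  dec :: "'a \<Rightarrow> bool list \<Rightarrow> (nat \<Rightarrow> 'a \<Rightarrow> bool list) \<Rightarrow> bool"

definition view :: "('a \<Rightarrow> 'a \<Rightarrow> bool) \<Rightarrow> (nat \<Rightarrow> 'a \<Rightarrow> bool list) \<Rightarrow> 'a \<Rightarrow> nat \<Rightarrow> 'a \<Rightarrow> bool list" where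
  "view E h v = (\<lambda>s w. if E w v then h s w else [])"

text \<open>hist E P x r s u: message broadcast by u in round s, for s < r (else []).\<close>
primrec hist :: "('a \<Rightarrow> 'a \<Rightarrow> bool) \<Rightarrow> 'a protocol \<Rightarrow> ('a \<Rightarrow> bool list) \<Rightarrow> nat \<Rightarrow> nat \<Rightarrow> 'a \<Rightarrow> bool list" where
  "hist E P x 0 = (\<lambda>s u. [])"
| "hist E P x (Suc r) = (\<lambda>s u. if s = r then msg P r u (x u) (view E (hist E P x r) u)
                                 else hist E P x r s u)"

definition accepts :: "('a \<Rightarrow> 'a \<Rightarrow> bool) \<Rightarrow> 'a protocol \<Rightarrow> ('a \<Rightarrow> bool list) \<Rightarrow> 'a \<Rightarrow> bool" where
  "accepts E P x v = dec P v (x v) (view E (hist E P x (rounds P)) v)"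

definition static :: "'a set \<Rightarrow> 'a protocol \<Rightarrow> bool" where
  "static V P \<longleftrightarrow> (\<forall>r < rounds P. \<forall>u\<in>V. \<forall>b h. length (msg P r u b h) = len P r u)"

definition solves :: "'a set \<Rightarrow> ('a \<Rightarrow> 'a \<Rightarrow> bool) \<Rightarrow> nat \<Rightarrow> 'a protocol \<Rightarrow> bool" where
  "solves V E k P \<longleftrightarrow> static V P \<and>
     (\<forall>x. (\<forall>v\<in>V. length (x v) = k) \<longrightarrow>
        ((\<forall>u\<in>V. \<forall>w\<in>V. x u = x w) \<longrightarrow> (\<forall>v\<in>V. accepts E P x v)) \<and>
        ((\<exists>u\<in>V. \<exists>w\<in>V. x u \<noteq> x w) \<longrightarrow> (\<exists>v\<in>V. \<not> accepts E P x v)))"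

definition senders :: "'a set \<Rightarrow> 'a protocol \<Rightarrow> 'a set" where
  "senders V P = {u\<in>V. \<exists>r < rounds P. len P r u > 0}"

definition cost :: "'a set \<Rightarrow> 'a protocol \<Rightarrow> nat" where
  "cost V P = (\<Sum>u\<in>V. \<Sum>r<rounds P. len P r u)"

definition opt_k :: "'a set \<Rightarrow> ('a \<Rightarrow> 'a \<Rightarrow> bool) \<Rightarrow> nat \<Rightarrow> nat" where
  "opt_k V E k = (LEAST c. \<exists>P. solves V E k P \<and> cost V P = c)"

end

theory Submission
  imports Defs "HOL-Library.FuncSet"
begin

text \<open>
  Inputs are encoded as pairs \<open>(a, b)\<close> of vectors in a box of the lattice of rank \<open>d\<close>, with \<open>b\<close> on a
  fixed sphere; as in Behrend's construction, the sphere costs only a factor \<open>2 ^ o(k)\<close> in the number of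
  pairs. A vertex \<open>v\<close> of the total vertex cover broadcasts \<open>a + c v * b\<close>, which takes half of the bits of
  \<open>(a, b)\<close>, and its neighbours compare this with their own value. Here \<open>c\<close> is an \<open>st\<close>-numbering for an
  edge \<open>st\<close> inside the cover.

  Suppose that all checks succeed. Adjacent vertices of the cover then agree, so \<open>s\<close> and \<open>t\<close> agree. Let
  \<open>h v z\<close> be the inner product of \<open>(a v - a s) + z * (b v - b s)\<close> with \<open>b s\<close>. It is affine in \<open>z\<close>,
  non-increasing because \<open>b v\<close> and \<open>b s\<close> lie on one sphere, and constant only if \<open>b v = b s\<close>; moreover
  \<open>h u\<close> and \<open>h v\<close> agree at \<open>c v\<close> for each edge \<open>uv\<close> with \<open>v\<close> in the cover. Climbing from \<open>s\<close> gives
  \<open>h v (c v) \<le> 0\<close>, descending from \<open>t\<close> gives \<open>h v (c v) \<ge> 0\<close>. As every vertex \<open>v\<close> has a neighbour \<open>w\<close>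
  in the cover, \<open>h v\<close> vanishes at both \<open>c v\<close> and \<open>c w\<close>, whence \<open>b v = b s\<close>.
\<close>

section \<open>Numberings of 2-connected graphs\<close>

text \<open>The codomain may be any linear order: real values leave room to insert an ear between
  two existing values, while the protocol needs natural numbers as coefficients.\<close>

definition st_numbering ::
    "'a set \<Rightarrow> ('a \<Rightarrow> 'a \<Rightarrow> bool) \<Rightarrow> 'a \<Rightarrow> 'a \<Rightarrow> ('a \<Rightarrow> 'b::linorder) \<Rightarrow> bool" where
  "st_numbering W E s t c \<longleftrightarrow> s \<in> W \<and> t \<in> W \<and> inj_on c W \<and>
     (\<forall>v\<in>W - {s}. \<exists>u\<in>W. E v u \<and> c u < c v) \<and>
     (\<forall>v\<in>W - {t}. \<exists>u\<in>W. E v u \<and> c v < c u)"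

lemma rtranclp_leaves_set:
  assumes "R\<^sup>*\<^sup>* x z" "x \<in> W" "z \<notin> W"
  shows "\<exists>u y. R u y \<and> u \<in> W \<and> y \<notin> W"
  using assms by (induction rule: rtranclp_induct) auto

lemma connected_on_edge_leaving:
  assumes "connected_on V E" "W \<subseteq> V" "W \<noteq> {}" "W \<noteq> V"
  obtains u y where "E u y" "u \<in> W" "y \<in> V - W"
proof -
  obtain x z where "x \<in> W" "z \<in> V - W"
    using assms by blast
  moreover from this have "(\<lambda>a b. E a b \<and> a \<in> V \<and> b \<in> V)\<^sup>*\<^sup>* x z"
    using assms unfolding connected_on_def by blast
  ultimately show ?thesis
    using rtranclp_leaves_set[of _ x z W] that by blast
qed

text \<open>Leave \<open>W\<close> along an edge from \<open>u\<close> to \<open>y\<close> and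
  return from \<open>y\<close> to \<open>W - {u}\<close> while avoiding \<open>u\<close>, which is
  possible because \<open>V - {u}\<close> is connected. A shortest such walk repeats no vertex and
  meets \<open>W\<close> only at its end.\<close>

lemma two_connected_ear:
  assumes G: "two_connected V E" and W: "W \<subseteq> V" "s \<in> W" "t \<in> W" "s \<noteq> t" "W \<noteq> V"
  obtains q :: "nat \<Rightarrow> 'a" and m where
    "q 0 \<in> W" "q m \<in> W" "q 0 \<noteq> q m" "m \<ge> 2"
    "\<And>i. 0 < i \<Longrightarrow> i < m \<Longrightarrow> q i \<in> V - W" "inj_on q {..m}"
    "\<And>i. i < m \<Longrightarrow> E (q i) (q (Suc i))"
proof -
  have conn: "connected_on V E" and conn': "\<And>x. x \<in> V \<Longrightarrow> connected_on (V - {x}) E"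
    using G unfolding two_connected_def by auto
  obtain u y where uy: "E u y" "u \<in> W" "y \<in> V - W"
    using connected_on_edge_leaving[OF conn W(1) _ W(5)] W(2) by blast
  \<comment> \<open>A second vertex of \<open>W\<close> guarantees that the return walk has a target
    other than \<open>u\<close>.\<close>
  obtain w where w: "w \<in> W" "w \<noteq> u" using W by metis
  define R where "R = (\<lambda>a b. E a b \<and> a \<in> V - {u} \<and> b \<in> V - {u})"
  define P where "P n \<longleftrightarrow> (\<exists>z\<in>W - {u}. (R ^^ n) y z)" for n
  have "R\<^sup>*\<^sup>* y w"
    using conn'[of u] uy w W(1) unfolding connected_on_def R_def by blast
  then have ex: "\<exists>n. P n"
    using w rtranclp_imp_relpowp[of R y w] unfolding P_def by blast
  define n where "n = (LEAST n. P n)"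
  have Pn: "P n" unfolding n_def using ex by (rule LeastI_ex)
  have minimal: "n \<le> i" if "P i" for i
    unfolding n_def using that by (rule Least_le)
  obtain z f where z: "z \<in> W - {u}" and f0: "f 0 = y" and fn: "f n = z"
    and fR: "\<And>i. i < n \<Longrightarrow> R (f i) (f (Suc i))"
    using Pn unfolding P_def relpowp_fun_conv by blast
  have npos: "n > 0" using f0 fn z uy by (cases n) auto
  have fV: "f i \<in> V - {u}" if "i \<le> n" for i
  proof (cases "i < n")
    case True then show ?thesis using fR unfolding R_def by blast
  next
    case False then show ?thesis using that fn z W(1) by auto
  qed
  have pre: "(R ^^ i) y (f i)" if "i \<le> n" for i
    unfolding relpowp_fun_conv using that f0 fR by (intro exI[of _ f]) auto
  have post: "(R ^^ (n - j)) (f j) z" if "j \<le> n" for j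
    unfolding relpowp_fun_conv using that fn fR by (intro exI[of _ "\<lambda>i. f (j + i)"]) auto
  have fW: "f i \<notin> W" if "i < n" for i
  proof
    assume "f i \<in> W"
    then have "P i" using pre[of i] fV[of i] that unfolding P_def by auto
    then show False using minimal that by force
  qed
  \<comment> \<open>If a vertex were repeated, the piece between positions \<open>i\<close> and
    \<open>j\<close> could be cut out, leaving a shorter walk.\<close>
  have finj: "f i \<noteq> f j" if "i < j" "j \<le> n" for i j
  proof
    assume "f i = f j"
    then have "(R ^^ (i + (n - j))) y z"
      using relpowp_trans[OF pre[of i] post[of j, folded \<open>f i = f j\<close>]] that by simp
    then have "P (i + (n - j))" using z unfolding P_def by blast
    then show False using minimal that by force
  qed
  define q where "q i = (case i of 0 \<Rightarrow> u | Suc j \<Rightarrow> f j)" for i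
  have q0: "q 0 = u" and qS: "\<And>j. q (Suc j) = f j" by (auto simp: q_def)
  show ?thesis
  proof (rule that[of q "Suc n"])
    show "q 0 \<in> W" "q (Suc n) \<in> W" "q 0 \<noteq> q (Suc n)" "2 \<le> Suc n"
      using uy z fn npos by (auto simp: q0 qS)
    show "q i \<in> V - W" if "0 < i" "i < Suc n" for i
      using that fV fW by (cases i) (auto simp: qS)
    have neq: "q i \<noteq> q j" if "i < j" "j \<le> Suc n" for i j
      using that finj fV[of "j - 1"] by (cases i; cases j) (auto simp: q0 qS)
    show "inj_on q {..Suc n}"
      by (intro inj_onI) (metis atMost_iff linorder_neqE_nat neq)
    show "E (q i) (q (Suc i))" if "i < Suc n" for i
      using that uy f0 fR by (cases i) (auto simp: q0 qS R_def)
  qed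
qed

text \<open>Interior vertices of the ear get increasing values in the gap just above
  \<open>c (q 0)\<close>, so each has its predecessor below it and its successor above it. Vertices
  of \<open>W\<close> keep their values, and with them their lower and higher neighbours.\<close>

lemma st_numbering_extend:
  fixes c :: "'a \<Rightarrow> real"
  assumes sym: "\<And>u v. E u v \<Longrightarrow> E v u" and fin: "finite W"
    and st: "st_numbering W E s t c"
    and q: "q 0 \<in> W" "q m \<in> W" "c (q 0) < c (q m)"
      "\<And>i. 0 < i \<Longrightarrow> i < m \<Longrightarrow> q i \<notin> W" "inj_on q {..m}"
      "\<And>i. i < m \<Longrightarrow> E (q i) (q (Suc i))"
  shows "\<exists>c'::'a \<Rightarrow> real. st_numbering (W \<union> q ` {..m}) E s t c'"
proof -
  \<comment> \<open>\<open>e\<close> is the distance from \<open>c (q 0)\<close> to the next larger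
    value on \<open>W\<close>; no old value lies strictly between \<open>c (q 0)\<close> and
    \<open>c (q 0) + e\<close>.\<close>
  define e where "e = Min ((\<lambda>w. c w - c (q 0)) ` {w\<in>W. c (q 0) < c w})"
  let ?D = "(\<lambda>w. c w - c (q 0)) ` {w\<in>W. c (q 0) < c w}"
  have D: "finite ?D" "?D \<noteq> {}" using fin q by auto
  have epos: "e > 0" using Min_in[OF D] unfolding e_def by auto
  have gap: "c (q 0) + e \<le> c w" if "w \<in> W" "c (q 0) < c w" for w
    using Min_le[OF D(1), of "c w - c (q 0)"] that unfolding e_def by auto
  have mpos: "m > 0" using q(3) by (cases m) auto
  define g where "g i = c (q 0) + e * real i / real m" for i :: nat
  have gmono: "g i < g j" if "i < j" for i j
    using that epos mpos unfolding g_def by (simp add: divide_strict_right_mono)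
  define c' where "c' v = (if v \<in> W then c v else g (inv_into {..m} q v))" for v
  have cW: "c' v = c v" if "v \<in> W" for v using that by (simp add: c'_def)
  have cq: "c' (q i) = g i" if "0 < i" "i < m" for i
    using that q(4,5) by (simp add: c'_def inv_into_f_f)
  have g0: "g 0 = c (q 0)" and gm: "g m \<le> c (q m)"
    using gap[OF q(2,3)] mpos by (auto simp: g_def)
  \<comment> \<open>On the last edge the old value \<open>c (q m)\<close> may exceed
    \<open>g m\<close>, which only widens the inequality.\<close>
  have step: "c' (q i) < c' (q (Suc i))" if "i < m" for i
  proof -
    have "c' (q i) = g i"
      using that cq g0 cW[OF q(1)] by (cases "i = 0") auto
    moreover have "g (Suc i) \<le> c' (q (Suc i))"
      using that cq[of "Suc i"] gm cW[OF q(2)] by (cases "Suc i = m") auto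
    ultimately show ?thesis using gmono[of i "Suc i"] by linarith
  qed
  have new: "\<exists>i. 0 < i \<and> i < m \<and> v = q i"
    if v: "v \<in> W \<union> q ` {..m}" "v \<notin> W" for v
  proof -
    obtain i where "i \<le> m" "v = q i" using v by blast
    moreover from this have "i \<noteq> 0" "i \<noteq> m" using v(2) q(1,2) by metis+
    ultimately show ?thesis by (intro exI[of _ i]) auto
  qed
  have g_sep: "g i \<noteq> c w" if "0 < i" "i < m" "w \<in> W" for i w
  proof (cases "c (q 0) < c w")
    case True
    have "g i < c (q 0) + e" using gmono[OF that(2)] mpos by (simp add: g_def)
    then show ?thesis using gap[OF that(3) True] by linarith
  next
    case False
    then show ?thesis using gmono[OF that(1)] g0 by linarith
  qed
  have "inj_on c' (W \<union> q ` {..m})"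
  proof (rule inj_onI)
    fix x y assume xy: "x \<in> W \<union> q ` {..m}" "y \<in> W \<union> q ` {..m}" "c' x = c' y"
    have ginj: "i = j" if "g i = g j" for i j
      using that gmono by (metis less_irrefl linorder_neqE_nat)
    have cinj: "inj_on c W" using st unfolding st_numbering_def by blast
    consider "x \<in> W" "y \<in> W" | "x \<in> W" "y \<notin> W" | "x \<notin> W" "y \<in> W" | "x \<notin> W" "y \<notin> W"
      by blast
    then show "x = y"
    proof cases
      case 1
      then show ?thesis using inj_onD[OF cinj, of x y] xy(3) cW by simp
    next
      case 2
      obtain j where j: "0 < j" "j < m" "y = q j" using new[OF xy(2) 2(2)] by blast
      then have "g j = c x" using xy(3) cq[OF j(1,2)] cW[OF 2(1)] by simp
      then show ?thesis using g_sep[OF j(1,2) 2(1)] by contradiction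
    next
      case 3
      obtain i where i: "0 < i" "i < m" "x = q i" using new[OF xy(1) 3(1)] by blast
      then have "g i = c y" using xy(3) cq[OF i(1,2)] cW[OF 3(2)] by simp
      then show ?thesis using g_sep[OF i(1,2) 3(2)] by contradiction
    next
      case 4
      obtain i j where i: "0 < i" "i < m" "x = q i" and j: "0 < j" "j < m" "y = q j"
        using new[OF xy(1) 4(1)] new[OF xy(2) 4(2)] by blast
      then show ?thesis using ginj[of i j] xy(3) cq[OF i(1,2)] cq[OF j(1,2)] by simp
    qed
  qed
  moreover have "\<exists>u\<in>W \<union> q ` {..m}. E v u \<and> c' u < c' v" if v: "v \<in> W \<union> q ` {..m} - {s}" for v
  proof (cases "v \<in> W")
    case True
    then obtain u where "u \<in> W" "E v u" "c u < c v"
      using st v unfolding st_numbering_def by blast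
    then show ?thesis using True cW by (intro bexI[of _ u]) auto
  next
    case False
    then obtain i where i: "0 < i" "i < m" "v = q i" using new v by blast
    then have "E v (q (i - 1))" "c' (q (i - 1)) < c' v"
      using q(6)[of "i - 1"] step[of "i - 1"] sym by auto
    then show ?thesis using i by (intro bexI[of _ "q (i - 1)"]) auto
  qed
  moreover have "\<exists>u\<in>W \<union> q ` {..m}. E v u \<and> c' v < c' u" if v: "v \<in> W \<union> q ` {..m} - {t}" for v
  proof (cases "v \<in> W")
    case True
    then obtain u where "u \<in> W" "E v u" "c v < c u"
      using st v unfolding st_numbering_def by blast
    then show ?thesis using True cW by (intro bexI[of _ u]) auto
  next
    case False
    then obtain i where i: "0 < i" "i < m" "v = q i" using new v by blast
    then show ?thesis using q(6)[of i] step[of i] by (intro bexI[of _ "q (Suc i)"]) auto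
  qed
  ultimately show ?thesis
    using st unfolding st_numbering_def by (intro exI[of _ c']) auto
qed

text \<open>An ear decomposition phrased extremally: among the vertex sets that carry such a
  numbering, starting from \<open>{s, t}\<close>, a maximal one must be \<open>V\<close>, since
  otherwise an ear could be added.\<close>

lemma two_connected_real_st_numbering:
  assumes G: "two_connected V E" and edge: "E s t"
  shows "\<exists>c::'a \<Rightarrow> real. st_numbering V E s t c"
proof -
  have fin: "finite V" and sym: "\<And>u v. E u v \<Longrightarrow> E v u"
    and stV: "s \<in> V" "t \<in> V" "s \<noteq> t"
    using G edge unfolding two_connected_def graph_def by blast+
  define \<W> where "\<W> = {W. W \<subseteq> V \<and> (\<exists>c::'a \<Rightarrow> real. st_numbering W E s t c)}"
  have "st_numbering {s, t} E s t (\<lambda>v. if v = s then 0 else 1 :: real)"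
    using stV edge sym unfolding st_numbering_def by (auto simp: inj_on_def)
  then have "{s, t} \<in> \<W>" using stV unfolding \<W>_def by blast
  moreover have finW: "finite \<W>"
    by (rule finite_subset[of _ "Pow V"]) (use fin in \<open>auto simp: \<W>_def\<close>)
  ultimately obtain W where W: "W \<in> \<W>" and maxW: "\<And>W'. W' \<in> \<W> \<Longrightarrow> W \<subseteq> W' \<Longrightarrow> W = W'"
    using finite_has_maximal[of \<W>] by (metis empty_iff)
  obtain c :: "'a \<Rightarrow> real" where c: "st_numbering W E s t c" and WV: "W \<subseteq> V"
    using W unfolding \<W>_def by blast
  have stW: "s \<in> W" "t \<in> W" using c unfolding st_numbering_def by auto
  have "W = V"
  proof (rule ccontr)
    assume "W \<noteq> V"
    then obtain q m where q: "q 0 \<in> W" "q m \<in> W" "q 0 \<noteq> q m" "m \<ge> 2"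
      "\<And>i. 0 < i \<Longrightarrow> i < m \<Longrightarrow> q i \<in> V - W" "inj_on q {..m}"
      "\<And>i. i < m \<Longrightarrow> E (q i) (q (Suc i))"
      using two_connected_ear[OF G WV stW stV(3)] by metis
    have qV: "q ` {..m} \<subseteq> V"
    proof (clarify)
      fix i assume "i \<le> m"
      then show "q i \<in> V" using q(1,2) q(5)[of i] WV by (cases "i = 0"; cases "i = m") auto
    qed
    have finW': "finite W" using WV fin finite_subset by blast
    have "c (q 0) \<noteq> c (q m)"
      using q(1-3) c unfolding st_numbering_def by (auto dest: inj_onD)
    then consider "c (q 0) < c (q m)" | "c (q m) < c (q 0)" by linarith
    then have "\<exists>c'::'a \<Rightarrow> real. st_numbering (W \<union> q ` {..m}) E s t c'"
    proof cases
      case 1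
      show ?thesis
        by (rule st_numbering_extend[OF sym finW' c]) (use q 1 in auto)
    next
      case 2
      \<comment> \<open>Ears are inserted in the direction of increasing \<open>c\<close>, so this
        one is traversed backwards.\<close>
      let ?q = "\<lambda>i. q (m - i)"
      have im: "(\<lambda>i. m - i) ` {..m} = {..m}"
      proof
        show "{..m} \<subseteq> (\<lambda>i. m - i) ` {..m}"
        proof
          fix i assume "i \<in> {..m}"
          then show "i \<in> (\<lambda>i. m - i) ` {..m}" by (intro image_eqI[of _ _ "m - i"]) auto
        qed
      qed auto
      have "\<exists>c'::'a \<Rightarrow> real. st_numbering (W \<union> ?q ` {..m}) E s t c'"
      proof (rule st_numbering_extend[OF sym finW' c])
        show "inj_on ?q {..m}"
        proof (rule inj_onI)
          fix i j assume ij: "i \<in> {..m}" "j \<in> {..m}" "?q i = ?q j"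
          then have "m - i = m - j" using inj_onD[OF q(6) ij(3)] by simp
          then show "i = j" using ij by simp
        qed
        show "E (?q i) (?q (Suc i))" if "i < m" for i
          using q(7)[of "m - Suc i"] that sym by (simp add: Suc_diff_Suc)
      qed (use q 2 in auto)
      moreover have "?q ` {..m} = q ` {..m}"
        using im by (metis image_image)
      ultimately show ?thesis by simp
    qed
    then have "W \<union> q ` {..m} \<in> \<W>" using WV qV unfolding \<W>_def by blast
    \<comment> \<open>Since \<open>m \<ge> 2\<close>, the vertex \<open>q 1\<close> is interior to
      the ear and hence outside \<open>W\<close>.\<close>
    then have "q 1 \<in> W" using maxW q(4) by (metis Un_upper1 UnI2 atMost_iff image_eqI one_le_numeral order_trans)
    then show False using q(4) q(5)[of 1] by auto
  qed
  then show ?thesis using c by blast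
qed

text \<open>Replacing real values by their ranks keeps the order and bounds the coefficients in
  terms of the graph alone, so they lengthen each coordinate by a number of bits independent of
  \<open>k\<close>.\<close>

lemma two_connected_st_numbering:
  assumes G: "two_connected V E" and edge: "E s t"
  obtains c :: "'a \<Rightarrow> nat" where "st_numbering V E s t c" "\<And>v. v \<in> V \<Longrightarrow> c v < card V"
proof -
  have fin: "finite V" using G unfolding two_connected_def graph_def by blast
  obtain \<pi> :: "'a \<Rightarrow> real" where \<pi>: "st_numbering V E s t \<pi>"
    using two_connected_real_st_numbering[OF G edge] by blast
  define c where "c v = card {w\<in>V. \<pi> w < \<pi> v}" for v
  have mono: "c u < c v" if "u \<in> V" "\<pi> u < \<pi> v" for u v
    unfolding c_def by (rule psubset_card_mono) (use that fin in auto)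
  have bound: "c v < card V" if "v \<in> V" for v
    unfolding c_def by (rule psubset_card_mono) (use that fin in auto)
  have "inj_on c V"
  proof (rule inj_onI)
    fix x y assume xy: "x \<in> V" "y \<in> V" "c x = c y"
    then have "\<pi> x = \<pi> y" using mono by (metis less_irrefl linorder_neqE_linordered_idom)
    then show "x = y" using \<pi> xy unfolding st_numbering_def by (auto dest: inj_onD)
  qed
  then have "st_numbering V E s t c"
    using \<pi> mono unfolding st_numbering_def by (metis DiffD1)
  then show ?thesis using that bound by blast
qed

section \<open>Rigidity of the local checks\<close>

text \<open>For vectors of equal norm, the squared distance of \<open>x\<close> and \<open>y\<close>
  is \<open>-2\<close> times the inner product of \<open>x - y\<close> with
  \<open>y\<close>.\<close>

lemma equal_on_sphere:
  fixes x y :: "nat \<Rightarrow> int"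
  assumes "(\<Sum>i<d. (x i)\<^sup>2) = R" "(\<Sum>i<d. (y i)\<^sup>2) = R"
  shows "(\<Sum>i<d. (x i - y i) * y i) \<le> 0"
    and "(\<Sum>i<d. (x i - y i) * y i) = 0 \<Longrightarrow> i < d \<Longrightarrow> x i = y i"
proof -
  have "(\<Sum>i<d. (x i - y i)\<^sup>2) = (\<Sum>i<d. (x i)\<^sup>2 - (y i)\<^sup>2 - 2 * ((x i - y i) * y i))"
    by (intro sum.cong) (auto simp: power2_eq_square algebra_simps)
  also have "\<dots> = - 2 * (\<Sum>i<d. (x i - y i) * y i)"
    using assms by (simp add: sum_subtractf sum_distrib_left[symmetric])
  finally have eq: "(\<Sum>i<d. (x i - y i)\<^sup>2) = - 2 * (\<Sum>i<d. (x i - y i) * y i)" .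
  have "(\<Sum>i<d. (x i - y i)\<^sup>2) \<ge> 0" by (intro sum_nonneg) auto
  then show "(\<Sum>i<d. (x i - y i) * y i) \<le> 0" using eq by linarith
  assume "(\<Sum>i<d. (x i - y i) * y i) = 0" "i < d"
  then have "(\<Sum>i<d. (x i - y i)\<^sup>2) = 0" using eq by simp
  then show "x i = y i" using \<open>i < d\<close> by (simp add: sum_nonneg_eq_0_iff)
qed

lemma local_checks_rigid:
  fixes a b :: "'a \<Rightarrow> nat \<Rightarrow> int" and c :: "'a \<Rightarrow> nat"
  assumes G: "graph V E" and conn: "connected_on V E" and S: "is_tvc V E S"
    and c: "st_numbering V E s t c" and st: "s \<in> S" "t \<in> S" "E s t"
    and sphere: "\<And>v. v \<in> V \<Longrightarrow> (\<Sum>i<d. (b v i)\<^sup>2) = R"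
    and check: "\<And>u v i. E u v \<Longrightarrow> v \<in> S \<Longrightarrow> i < d \<Longrightarrow>
        a u i + int (c v) * b u i = a v i + int (c v) * b v i"
  shows "v \<in> V \<Longrightarrow> i < d \<Longrightarrow> a v i = a s i \<and> b v i = b s i"
proof -
  have sym: "E v u" if "E u v" for u v using G that unfolding graph_def by blast
  have EV: "u \<in> V" "v \<in> V" "u \<noteq> v" if "E u v" for u v using G that unfolding graph_def by blast+
  have sV: "s \<in> V" using st EV by blast
  have cneq: "c u \<noteq> c v" if "E u v" for u v
    using c EV[OF that] unfolding st_numbering_def by (auto dest: inj_onD)
  \<comment> \<open>Both endpoints broadcast, so two affine functions of the coefficient agree at
    the distinct points \<open>c u\<close> and \<open>c v\<close> and therefore coincide.\<close>
  have SS: "a u i = a v i \<and> b u i = b v i" if "E u v" "u \<in> S" "v \<in> S" "i < d" for u v i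
  proof -
    have 1: "a u i + int (c v) * b u i = a v i + int (c v) * b v i"
      using check that by blast
    have 2: "a v i + int (c u) * b v i = a u i + int (c u) * b u i"
      using check sym that by blast
    have "(int (c u) - int (c v)) * (b u i - b v i) = 0"
      using 1 2 by (simp add: algebra_simps)
    then have "b u i = b v i" using cneq[OF that(1)] by simp
    then show ?thesis using 1 by simp
  qed
  \<comment> \<open>Projecting onto \<open>b s\<close> turns the vector equations into scalar ones;
    \<open>g v\<close> is the slope of the affine function \<open>h v\<close>.\<close>
  define h where "h v z = (\<Sum>i<d. (a v i - a s i + int z * (b v i - b s i)) * b s i)" for v z
  define g where "g v = (\<Sum>i<d. (b v i - b s i) * b s i)" for v
  have h_diff: "h v y = h v z + (int y - int z) * g v" for v y z
    unfolding h_def g_def sum_distrib_left sum.distrib[symmetric]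
    by (intro sum.cong) (auto simp: algebra_simps)
  have g_le: "g v \<le> 0" if "v \<in> V" for v
    unfolding g_def using equal_on_sphere(1)[OF sphere[OF that] sphere[OF sV]] .
  have anti: "h v y \<le> h v z" if "v \<in> V" "z \<le> y" for v y z
    using h_diff[of v y z] g_le[OF that(1)] that(2) mult_nonneg_nonpos[of "int y - int z" "g v"]
    by simp
  have h_edge: "h u (c v) = h v (c v)" if "E u v" "v \<in> S" for u v
    unfolding h_def
  proof (intro sum.cong refl)
    fix i assume "i \<in> {..<d}"
    then have "a u i + int (c v) * b u i = a v i + int (c v) * b v i" using check that by auto
    then have "a u i - a s i + int (c v) * (b u i - b s i) = a v i - a s i + int (c v) * (b v i - b s i)"
      by (simp add: algebra_simps)
    then show "(a u i - a s i + int (c v) * (b u i - b s i)) * b s i =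
        (a v i - a s i + int (c v) * (b v i - b s i)) * b s i" by simp
  qed
  have hs: "h s z = 0" for z unfolding h_def by simp
  have ht: "h t z = 0" for z
    unfolding h_def using SS[OF st(3) st(1,2)] by simp
  have cover: "u \<in> S \<or> v \<in> S" if "E u v" for u v using S that unfolding is_tvc_def by blast
  \<comment> \<open>For a lower neighbour \<open>u\<close>, the check is made at \<open>c u\<close>
    if \<open>u \<in> S\<close>, and otherwise at \<open>c v\<close>, where \<open>v \<in> S\<close>
    by the cover property. Either way monotonicity carries the sign from \<open>h u (c u)\<close> to
    \<open>h v (c v)\<close>.\<close>
  have up: "h v (c v) \<le> 0" if "v \<in> V" for v
    using that
  proof (induction "c v" arbitrary: v rule: less_induct)
    case less
    show ?case
    proof (cases "v = s")
      case True then show ?thesis using hs by simp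
    next
      case False
      then obtain u where u: "u \<in> V" "E v u" "c u < c v"
        using c less.prems unfolding st_numbering_def by blast
      have IH: "h u (c u) \<le> 0" using less.hyps u by blast
      show ?thesis
      proof (cases "u \<in> S")
        case True
        then show ?thesis using h_edge[OF u(2)] IH anti[OF less.prems, of "c u" "c v"] u(3) by simp
      next
        case False
        then have "v \<in> S" using cover u by blast
        then show ?thesis using h_edge[OF sym[OF u(2)]] IH anti[OF u(1), of "c u" "c v"] u(3) by simp
      qed
    qed
  qed
  have down: "h v (c v) \<ge> 0" if "v \<in> V" for v
    using that
  \<comment> \<open>Induction from the top of the numbering, mirroring the previous
    argument.\<close>
  proof (induction "Max (c ` V) - c v" arbitrary: v rule: less_induct)
    case less
    show ?case
    proof (cases "v = t")
      case True then show ?thesis using ht by simp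
    next
      case False
      then obtain u where u: "u \<in> V" "E v u" "c v < c u"
        using c less.prems unfolding st_numbering_def by blast
      have "c u \<le> Max (c ` V)" using u G unfolding graph_def by auto
      then have IH: "h u (c u) \<ge> 0" using less.hyps[of u] u by simp
      show ?thesis
      proof (cases "u \<in> S")
        case True
        then show ?thesis using h_edge[OF u(2)] IH anti[OF less.prems, of "c v" "c u"] u(3) by simp
      next
        case False
        then have "v \<in> S" using cover u by blast
        then show ?thesis using h_edge[OF sym[OF u(2)]] IH anti[OF u(1), of "c v" "c u"] u(3) by simp
      qed
    qed
  qed
  have h0: "h v (c v) = 0" if "v \<in> V" for v using up down that by (simp add: antisym)
  \<comment> \<open>Total domination supplies a second zero \<open>c w\<close> of the affine
    function \<open>h v\<close>, so its slope vanishes.\<close>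
  have g0: "g v = 0" if v: "v \<in> V" for v
  proof -
    obtain w where w: "w \<in> S" "E v w" using S v unfolding is_tvc_def by blast
    have "h v (c w) = 0" using h_edge[OF w(2,1)] h0 EV[OF w(2)] by simp
    then have "(int (c v) - int (c w)) * g v = 0"
      using h_diff[of v "c v" "c w"] h0[OF v] by simp
    then show ?thesis using cneq[OF w(2)] by simp
  qed
  have beq: "b v i = b s i" if "v \<in> V" "i < d" for v i
    using equal_on_sphere(2)[OF sphere[OF that(1)] sphere[OF sV]] g0[OF that(1)] that(2)
    unfolding g_def by blast
  \<comment> \<open>Once all \<open>b\<close> agree, the check on an edge reduces to equality of the
    \<open>a\<close> values.\<close>
  have aedge: "a u i = a v i" if "E u v" "i < d" for u v i
    using cover[OF that(1)] check[OF that(1) _ that(2)] check[OF sym[OF that(1)] _ that(2)]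
      beq[OF EV(1)[OF that(1)] that(2)] beq[OF EV(2)[OF that(1)] that(2)] by auto
  show "a v i = a s i \<and> b v i = b s i" if "v \<in> V" "i < d"
  proof -
    have "(\<lambda>a b. E a b \<and> a \<in> V \<and> b \<in> V)\<^sup>*\<^sup>* s v"
      using conn sV that unfolding connected_on_def by blast
    then have "a v i = a s i"
      by (induction rule: rtranclp_induct) (use aedge that(2) in auto)
    then show ?thesis using beq that by blast
  qed
qed

section \<open>Counting and encoding\<close>

lemma inj_into_bool_lists:
  assumes "finite A" "card A \<le> 2 ^ L"
  obtains f :: "'b \<Rightarrow> bool list" where "inj_on f A" "\<And>x. length (f x) = L"
proof -
  let ?B = "{xs :: bool list. length xs = L}"
  have B: "finite ?B" "card ?B = 2 ^ L"
    using finite_lists_length_eq[of "UNIV :: bool set" L] card_lists_length_eq[of "UNIV :: bool set" L]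
    by auto
  obtain f where f: "f ` A \<subseteq> ?B" "inj_on f A"
    using card_le_inj[OF assms(1) B(1) assms(2)[folded B(2)]] by blast
  \<comment> \<open>Outside \<open>A\<close> a default of the right length is used, because
    \<open>static\<close> fixes the message length for every input, even one of length other than
    \<open>k\<close>.\<close>
  let ?f = "\<lambda>x. if x \<in> A then f x else replicate L False"
  show ?thesis
    by (rule that[of ?f]) (use f in \<open>auto simp: inj_on_def\<close>)
qed

text \<open>Extensional functions make a point determined by its first \<open>d\<close> coordinates,
  so the grid is finite.\<close>

definition box :: "nat \<Rightarrow> int \<Rightarrow> (nat \<Rightarrow> int) set" where
  "box d M = {..<d} \<rightarrow>\<^sub>E {0..<M}"

lemma finite_box: "finite (box d M)"
  unfolding box_def by (intro finite_PiE) auto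

lemma card_box: "card (box d M) = nat M ^ d"
  unfolding box_def by (simp add: card_PiE)

lemma box_eqI:
  assumes "x \<in> box d M" "y \<in> box d M" "\<And>i. i < d \<Longrightarrow> x i = y i"
  shows "x = y"
  using assms unfolding box_def by (intro PiE_ext[of x _ _ y]) auto

text \<open>Pigeonhole: the \<open>2 ^ (d * p)\<close> points of the box have squared norms among
  \<open>d * 2 ^ (2 * p)\<close> values, so some sphere contains at least the average
  number.\<close>

lemma large_sphere:
  assumes "d > 0"
  obtains R where
    "card {b \<in> box d (2 ^ p). (\<Sum>i<d. (b i)\<^sup>2) = R} * (d * 2 ^ (2 * p)) \<ge> 2 ^ (d * p)"
proof -
  let ?B = "box d (2 ^ p)" and ?N = "\<lambda>b :: nat \<Rightarrow> int. \<Sum>i<d. (b i)\<^sup>2"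
  let ?T = "{0..<int (d * 2 ^ (2 * p))}"
  have "?N b \<in> ?T" if "b \<in> ?B" for b
  proof -
    have "(b i)\<^sup>2 < 2 ^ (2 * p)" if "i < d" for i
    proof -
      have "0 \<le> b i" "b i < 2 ^ p" using that \<open>b \<in> ?B\<close> unfolding box_def by (auto dest!: PiE_mem)
      then have "(b i)\<^sup>2 < (2 ^ p)\<^sup>2" by (intro power_strict_mono) auto
      then show ?thesis by (simp add: power_mult[symmetric] mult.commute)
    qed
    then have "?N b < (\<Sum>i<d. 2 ^ (2 * p))" using assms by (intro sum_strict_mono) auto
    then show ?thesis by (auto intro: sum_nonneg)
  qed
  then have "?B = (\<Union>R\<in>?T. {b \<in> ?B. ?N b = R})" by auto
  then have "card ?B \<le> (\<Sum>R\<in>?T. card {b \<in> ?B. ?N b = R})"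
    using card_UN_le[of ?T "\<lambda>R. {b \<in> ?B. ?N b = R}"] by simp
  then have le: "2 ^ (d * p) \<le> (\<Sum>R\<in>?T. card {b \<in> ?B. ?N b = R})"
    by (simp add: card_box nat_power_eq power_mult[symmetric] mult.commute)
  have "\<exists>R. 2 ^ (d * p) \<le> card {b \<in> ?B. ?N b = R} * (d * 2 ^ (2 * p))"
  proof (rule ccontr)
    assume no: "\<not> ?thesis"
    have T: "card ?T = d * 2 ^ (2 * p)" by (simp add: nat_mult_distrib nat_power_eq)
    have lt: "card {b \<in> ?B. ?N b = R} * card ?T < 2 ^ (d * p)" for R
      unfolding T using no by (simp only: not_ex not_le)
    have "(\<Sum>R\<in>?T. card {b \<in> ?B. ?N b = R}) * card ?T
        = (\<Sum>R\<in>?T. card {b \<in> ?B. ?N b = R} * card ?T)"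
      by (simp add: sum_distrib_right)
    also have "\<dots> < (\<Sum>R\<in>?T. 2 ^ (d * p))"
      using assms lt by (intro sum_strict_mono) auto
    also have "\<dots> = 2 ^ (d * p) * card ?T" by simp
    finally show False using le by simp
  qed
  then show ?thesis using that by blast
qed

text \<open>Restricting the second component to a large sphere loses a factor of at most
  \<open>d * 2 ^ (2 * p)\<close>. With the crude bound \<open>d \<le> 2 ^ d\<close> this is
  \<open>2 * p + d\<close> bits, which the hypothesis leaves available.\<close>

lemma input_encoding:
  assumes k: "k + 2 * p + d \<le> 2 * (d * p)" and d: "d > 0"
  obtains R and \<phi> :: "bool list \<Rightarrow> (nat \<Rightarrow> int) \<times> (nat \<Rightarrow> int)" where
    "inj_on \<phi> {xs. length xs = k}"
    "\<And>xs. length xs = k \<Longrightarrow> fst (\<phi> xs) \<in> box d (2 ^ p)"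
    "\<And>xs. length xs = k \<Longrightarrow> snd (\<phi> xs) \<in> box d (2 ^ p)"
    "\<And>xs. length xs = k \<Longrightarrow> (\<Sum>i<d. (snd (\<phi> xs) i)\<^sup>2) = R"
proof -
  obtain R where R:
    "card {b \<in> box d (2 ^ p). (\<Sum>i<d. (b i)\<^sup>2) = R} * (d * 2 ^ (2 * p)) \<ge> 2 ^ (d * p)"
    using large_sphere[OF d] by blast
  let ?B = "{b \<in> box d (2 ^ p). (\<Sum>i<d. (b i)\<^sup>2) = R}" and ?A = "box d (2 ^ p)"
  have cA: "card ?A = 2 ^ (d * p)"
    by (simp add: card_box nat_power_eq power_mult[symmetric] mult.commute)
  have "2 ^ k * 2 ^ (2 * p + d) \<le> (2::nat) ^ (d * p) * 2 ^ (d * p)"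
    unfolding power_add[symmetric] using k by (intro power_increasing) auto
  also have "\<dots> \<le> 2 ^ (d * p) * (card ?B * (d * 2 ^ (2 * p)))"
    using R by (intro mult_left_mono) auto
  also have "\<dots> \<le> 2 ^ (d * p) * (card ?B * (2 ^ d * 2 ^ (2 * p)))"
    using less_exp[of d] by (intro mult_left_mono mult_right_mono) auto
  also have "\<dots> = card (?A \<times> ?B) * 2 ^ (2 * p + d)"
    by (simp add: cA card_cartesian_product power_add)
  finally have le: "2 ^ k \<le> card (?A \<times> ?B)" by simp
  have L: "finite {xs :: bool list. length xs = k}" "card {xs :: bool list. length xs = k} = 2 ^ k"
    using finite_lists_length_eq[of "UNIV :: bool set" k] card_lists_length_eq[of "UNIV :: bool set" k]
    by auto
  have "finite (?A \<times> ?B)" using finite_box by auto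
  then obtain \<phi> where \<phi>: "\<phi> ` {xs :: bool list. length xs = k} \<subseteq> ?A \<times> ?B"
      "inj_on \<phi> {xs :: bool list. length xs = k}"
    using card_le_inj[OF L(1) _ le[folded L(2)]] by blast
  have mem: "\<phi> xs \<in> ?A \<times> ?B" if "length xs = k" for xs using \<phi>(1) that by blast
  show ?thesis
    by (rule that[of \<phi> R]) (use \<phi>(2) mem in \<open>fastforce simp: mem_Times_iff\<close>)+
qed

section \<open>The protocol\<close>

text \<open>A receiver evaluates the sender's function \<open>F w\<close> on its own input and
  compares, so acceptance means that no neighbour in \<open>S\<close> is seen to differ.\<close>

definition one_round :: "('a \<Rightarrow> 'a \<Rightarrow> bool) \<Rightarrow> 'a set \<Rightarrow> nat \<Rightarrow> ('a \<Rightarrow> bool list \<Rightarrow> bool list) \<Rightarrow> 'a protocol" where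
  "one_round E S L F = \<lparr>rounds = 1, len = (\<lambda>r u. if u \<in> S then L else 0),
     msg = (\<lambda>r u b h. if u \<in> S then F u b else []),
     dec = (\<lambda>v b h. \<forall>w\<in>S. E w v \<longrightarrow> h 0 w = F w b)\<rparr>"

lemma accepts_one_round:
  "accepts E (one_round E S L F) x v \<longleftrightarrow> (\<forall>w\<in>S. E w v \<longrightarrow> F w (x w) = F w (x v))"
  by (auto simp: accepts_def one_round_def view_def)

lemma static_one_round:
  assumes "\<And>u b. length (F u b) = L"
  shows "static V (one_round E S L F)"
  using assms by (auto simp: static_def one_round_def)

lemma senders_one_round: "senders V (one_round E S L F) \<subseteq> S"
  by (auto simp: senders_def one_round_def split: if_splits)

lemma cost_one_round:
  assumes "finite V" "S \<subseteq> V"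
  shows "cost V (one_round E S L F) = card S * L"
proof -
  have "cost V (one_round E S L F) = (\<Sum>u\<in>V. if u \<in> S then L else 0)"
    by (simp add: cost_def one_round_def)
  also have "\<dots> = card S * L"
    using assms by (simp add: sum.If_cases Int_absorb1)
  finally show ?thesis .
qed

lemma tvc_protocol:
  assumes G: "two_connected V E" and S: "is_tvc V E S"
    and k: "k + 2 * p + d \<le> 2 * (d * p)" and d: "d > 0"
  shows "\<exists>P. solves V E k P \<and> senders V P \<subseteq> S \<and> cost V P = card S * (d * (p + card V))"
proof -
  let ?L = "d * (p + card V)" and ?n = "card V"
  have gr: "graph V E" and conn: "connected_on V E" and fin: "finite V" and n3: "?n \<ge> 3"
    and sym: "\<And>u v. E u v \<Longrightarrow> E v u" and EV: "\<And>u v. E u v \<Longrightarrow> u \<in> V \<and> v \<in> V"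
    using G unfolding two_connected_def graph_def by blast+
  have SV: "S \<subseteq> V" using S unfolding is_tvc_def by blast
  obtain v0 where "v0 \<in> V" using n3 by fastforce
  then obtain s where s: "s \<in> S" using S unfolding is_tvc_def by blast
  \<comment> \<open>Total domination also applies to \<open>s\<close>, which gives an edge with both
    ends in \<open>S\<close>.\<close>
  then obtain t where t: "t \<in> S" "E s t" using S SV unfolding is_tvc_def by blast
  obtain c :: "'a \<Rightarrow> nat" where c: "st_numbering V E s t c" and c_lt: "\<And>v. v \<in> V \<Longrightarrow> c v < ?n"
    using two_connected_st_numbering[OF G t(2)] by blast
  obtain R and \<phi> :: "bool list \<Rightarrow> (nat \<Rightarrow> int) \<times> (nat \<Rightarrow> int)" where
    \<phi>: "inj_on \<phi> {xs. length xs = k}"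
    "\<And>xs. length xs = k \<Longrightarrow> fst (\<phi> xs) \<in> box d (2 ^ p)"
    "\<And>xs. length xs = k \<Longrightarrow> snd (\<phi> xs) \<in> box d (2 ^ p)"
    "\<And>xs. length xs = k \<Longrightarrow> (\<Sum>i<d. (snd (\<phi> xs) i)\<^sup>2) = R"
    using input_encoding[OF k d] by metis
  \<comment> \<open>Coordinates of \<open>a + c v * b\<close> are below \<open>?n * 2 ^ p\<close>,
    hence below \<open>2 ^ (p + ?n)\<close>; \<open>?n\<close> extra bits per coordinate are
    wasteful but independent of \<open>k\<close>.\<close>
  have "card (box d (2 ^ (p + ?n))) = 2 ^ ?L"
    by (simp add: card_box nat_power_eq power_mult[symmetric] mult.commute)
  then obtain \<psi> :: "(nat \<Rightarrow> int) \<Rightarrow> bool list" where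
    \<psi>: "inj_on \<psi> (box d (2 ^ (p + ?n)))" "\<And>x. length (\<psi> x) = ?L"
    using inj_into_bool_lists[OF finite_box[of d "2 ^ (p + ?n)"]] by (metis order_refl)
  define g where "g v xs = (\<lambda>i\<in>{..<d}. fst (\<phi> xs) i + int (c v) * snd (\<phi> xs) i)" for v xs
  define F where "F v xs = \<psi> (g v xs)" for v xs
  let ?P = "one_round E S ?L F"
  have g_box: "g v xs \<in> box d (2 ^ (p + ?n))" if v: "v \<in> V" and xs: "length xs = k" for v xs
  proof -
    have "g v xs i \<in> {0..<2 ^ (p + ?n)}" if "i < d" for i
    proof -
      have A: "0 \<le> fst (\<phi> xs) i" "fst (\<phi> xs) i < 2 ^ p"
        and B: "0 \<le> snd (\<phi> xs) i" "snd (\<phi> xs) i < 2 ^ p"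
        using \<phi>(2,3)[OF xs] that unfolding box_def by (auto dest!: PiE_mem)
      have "int (c v) * snd (\<phi> xs) i \<le> int (?n - 1) * 2 ^ p"
        using c_lt[OF v] B by (intro mult_mono) auto
      then have "g v xs i < (int (?n - 1) + 1) * 2 ^ p"
        using A that by (simp add: g_def algebra_simps)
      also have "\<dots> = int ?n * 2 ^ p" using n3 by simp
      also have "\<dots> \<le> 2 ^ ?n * 2 ^ p"
        by (intro mult_right_mono) (use less_exp[of ?n] in \<open>simp_all add: of_nat_less_two_power less_imp_le\<close>)
      finally have "g v xs i < 2 ^ (p + ?n)" by (simp add: power_add mult.commute)
      then show ?thesis using A B that by (simp add: g_def)
    qed
    then show ?thesis unfolding box_def by (auto simp: g_def)
  qed
  have rejects: "\<exists>v\<in>V. \<not> accepts E ?P x v"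
    if len: "\<forall>v\<in>V. length (x v) = k" and diff: "\<exists>u\<in>V. \<exists>w\<in>V. x u \<noteq> x w" for x
  proof (rule ccontr)
    assume "\<not> (\<exists>v\<in>V. \<not> accepts E ?P x v)"
    then have acc: "F w (x w) = F w (x v)" if "w \<in> S" "E w v" for v w
      using that EV by (auto simp: accepts_one_round)
    have check: "fst (\<phi> (x u)) i + int (c v) * snd (\<phi> (x u)) i
        = fst (\<phi> (x v)) i + int (c v) * snd (\<phi> (x v)) i"
      if "E u v" "v \<in> S" "i < d" for u v i
    proof -
      have uv: "u \<in> V" "v \<in> V" using EV that by auto
      have "g v (x v) = g v (x u)"
      proof (rule inj_onD[OF \<psi>(1)])
        show "\<psi> (g v (x v)) = \<psi> (g v (x u))"
          using acc[OF that(2) sym[OF that(1)]] unfolding F_def .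
      qed (use g_box[OF uv(2)] len uv in blast)+
      from fun_cong[OF this, of i] show ?thesis using that(3) by (simp add: g_def)
    qed
    have eq: "fst (\<phi> (x v)) i = fst (\<phi> (x s)) i \<and> snd (\<phi> (x v)) i = snd (\<phi> (x s)) i"
      if "v \<in> V" "i < d" for v i
    proof (rule local_checks_rigid[where a = "\<lambda>v. fst (\<phi> (x v))" and b = "\<lambda>v. snd (\<phi> (x v))"
          and d = d and R = R, OF gr conn S c s t])
      show "(\<Sum>i<d. (snd (\<phi> (x v)) i)\<^sup>2) = R" if "v \<in> V" for v
        using \<phi>(4) len that by blast
    qed (fact check that)+
    have "x v = x s" if v: "v \<in> V" for v
    proof -
      have l: "length (x v) = k" "length (x s) = k" using len v s SV by auto
      have "\<phi> (x v) = \<phi> (x s)"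
        using eq[OF v] box_eqI[OF \<phi>(2)[OF l(1)] \<phi>(2)[OF l(2)]]
          box_eqI[OF \<phi>(3)[OF l(1)] \<phi>(3)[OF l(2)]] by (simp add: prod_eq_iff)
      then show ?thesis using \<phi>(1) l by (auto dest: inj_onD)
    qed
    then show False using diff by metis
  qed
  have accepts: "\<forall>v\<in>V. accepts E ?P x v" if "\<forall>u\<in>V. \<forall>w\<in>V. x u = x w" for x
    unfolding accepts_one_round
  proof (intro ballI impI)
    fix v w assume "v \<in> V" "w \<in> S"
    then have "x w = x v" using that SV by blast
    then show "F w (x w) = F w (x v)" by simp
  qed
  have "static V ?P" by (rule static_one_round) (simp add: F_def \<psi>(2))
  then have "solves V E k ?P"
    unfolding solves_def by (intro conjI allI impI accepts rejects)
  then show ?thesis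
    using senders_one_round[of V E S ?L F] cost_one_round[OF fin SV, of E ?L F]
    by (intro exI[of _ ?P] conjI)
qed

text \<open>With dimension \<open>d\<close> about \<open>\<surd>k\<close> and coordinates of \<open>p\<close> about \<open>\<surd>k / 2\<close> bits, the loss \<open>2 * p + d\<close>
  from restricting to a sphere and the overhead \<open>d * n\<close> in the messages are both \<open>O(\<surd>k)\<close>.\<close>

lemma message_length_parameters:
  assumes "k > 0"
  obtains d p :: nat where "d > 0" "k + 2 * p + d \<le> 2 * (d * p)"
    "real (d * (p + n)) \<le> real k / 2 + (9 + 4 * real n) * sqrt (real k)"
proof -
  define q where "q = nat \<lceil>sqrt (real k)\<rceil>"
  have k1: "sqrt (real k) \<ge> 1" using assms by simp
  have q_ge: "sqrt (real k) \<le> real q" unfolding q_def by linarith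
  have q_le: "real q \<le> sqrt (real k) + 1" unfolding q_def using k1 by linarith
  have q1: "q \<ge> 1" "real q \<ge> 1" using k1 q_ge by linarith+
  \<comment> \<open>With \<open>d = q + 1\<close>, the required inequality becomes
    \<open>k + q + 1 \<le> 2 * q * p\<close>; the quotient plus one satisfies it.\<close>
  define p where "p = (k + q + 1) div (2 * q) + 1"
  have p_ge: "k + q + 1 \<le> 2 * q * p"
  proof -
    have "k + q + 1 = (k + q + 1) div (2 * q) * (2 * q) + (k + q + 1) mod (2 * q)"
      by (rule div_mult_mod_eq[symmetric])
    also have "\<dots> \<le> (k + q + 1) div (2 * q) * (2 * q) + 2 * q"
      using q1 mod_less_divisor[of "2 * q" "k + q + 1"] by linarith
    also have "\<dots> = 2 * q * p" unfolding p_def by (simp add: algebra_simps)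
    finally show ?thesis .
  qed
  have p_le: "real p \<le> (real k + real q + 1) / (2 * real q) + 1"
  proof -
    have "real ((k + q + 1) div (2 * q) * (2 * q)) \<le> real (k + q + 1)"
      unfolding of_nat_le_iff by (rule div_times_less_eq_dividend)
    then have "real ((k + q + 1) div (2 * q)) * (2 * real q) \<le> real k + real q + 1"
      by (simp only: of_nat_mult of_nat_add of_nat_numeral of_nat_1)
    then have "real ((k + q + 1) div (2 * q)) \<le> (real k + real q + 1) / (2 * real q)"
      using q1 by (simp only: pos_le_divide_eq)
    then show ?thesis unfolding p_def by (simp only: of_nat_add of_nat_1)
  qed
  have kq: "real k / real q \<le> sqrt (real k)"
  proof -
    have "real k = sqrt (real k) * sqrt (real k)" by simp
    also have "\<dots> \<le> sqrt (real k) * real q" using q_ge by (intro mult_left_mono) auto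
    finally show ?thesis using q1 by (simp add: field_simps)
  qed
  have "real ((q + 1) * (p + n)) = (real q + 1) * real p + (real q + 1) * real n"
    by (simp add: algebra_simps)
  also have "\<dots> \<le> (real q + 1) * ((real k + real q + 1) / (2 * real q) + 1) + (real q + 1) * real n"
    using p_le by (intro add_right_mono mult_left_mono) auto
  \<comment> \<open>The main term \<open>k / 2\<close> is isolated; all others are
    \<open>O(\<surd>k)\<close> because \<open>q\<close> is about \<open>\<surd>k\<close>.\<close>
  also have "\<dots> = real k / 2 + real k / real q / 2 + (real q + 2 + 1 / real q) / 2
      + (real q + 1) * (1 + real n)"
    using q1 by (simp add: field_simps)
  also have "\<dots> \<le> real k / 2 + sqrt (real k) / 2 + (sqrt (real k) + 4) / 2
      + (4 * sqrt (real k)) * (1 + real n)"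
  proof -
    have "1 / real q \<le> 1" using q1 by simp
    then have "real q + 2 + 1 / real q \<le> (sqrt (real k) + 1) + 2 + 1"
      using q_le by (intro add_mono order_refl)
    then have "(real q + 2 + 1 / real q) / 2 \<le> (sqrt (real k) + 4) / 2"
      by (intro divide_right_mono) simp_all
    moreover have "(real q + 1) * (1 + real n) \<le> (4 * sqrt (real k)) * (1 + real n)"
      using q_le k1 by (intro mult_right_mono) linarith+
    moreover have "real k / real q / 2 \<le> sqrt (real k) / 2"
      using kq by (intro divide_right_mono) simp_all
    ultimately show ?thesis by (intro add_mono order_refl)
  qed
  also have "\<dots> \<le> real k / 2 + (9 + 4 * real n) * sqrt (real k)"
  proof -
    have "y / 2 + r / 2 + (r + 4) / 2 + (4 * r) * (1 + real n) \<le> y / 2 + (9 + 4 * real n) * r"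
      if "1 \<le> r" for r y :: real
      using that by (simp add: field_simps)
    from this[OF k1] show ?thesis .
  qed
  finally have bound: "real ((q + 1) * (p + n)) \<le> real k / 2 + (9 + 4 * real n) * sqrt (real k)" .
  show ?thesis
    by (rule that[of "q + 1" p]) (use bound p_ge in \<open>auto simp: algebra_simps\<close>)
qed

section \<open>Minimum total vertex covers and the asymptotic bound\<close>

lemma two_connected_min_tvc:
  assumes "two_connected V E"
  obtains S where "is_min_tvc V E S"
proof -
  have gr: "graph V E" and conn: "connected_on V E" and n3: "card V \<ge> 3"
    using assms unfolding two_connected_def by auto
  have nb: "\<exists>u\<in>V. E v u" if v: "v \<in> V" for v
  proof -
    have "{v} \<noteq> V" using n3 by auto
    then show ?thesis
      using connected_on_edge_leaving[OF conn, of "{v}"] v by blast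
  qed
  \<comment> \<open>The whole vertex set is a total vertex cover since no vertex is isolated, so the
    minimum is attained.\<close>
  then have "is_tvc V E V"
    using gr unfolding is_tvc_def graph_def by blast
  then have "\<exists>S. is_tvc V E S \<and> card S = tvc V E"
    unfolding tvc_def by (intro LeastI_ex[of "\<lambda>n. \<exists>S. is_tvc V E S \<and> card S = n"]) blast
  then show ?thesis using that unfolding is_min_tvc_def by blast
qed

theorem theorem1p3:
  fixes V :: "'a set" and E :: "'a \<Rightarrow> 'a \<Rightarrow> bool"
  assumes "two_connected V E"
  shows "(\<exists>S. is_min_tvc V E S \<and>
            (\<exists>f :: nat \<Rightarrow> real. f \<in> o(\<lambda>k. real k) \<and>
               (\<forall>k>0. \<exists>P. solves V E k P \<and> senders V P \<subseteq> S \<and>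
                   real (cost V P) \<le> (real k / 2 + f k) * real (tvc V E))))
       \<and> limsup (\<lambda>k. ereal (real (opt_k V E k) / real k)) \<le> ereal (real (tvc V E) / 2)"
proof -
  obtain S where S: "is_min_tvc V E S" using two_connected_min_tvc[OF assms] .
  then have tvc: "is_tvc V E S" "card S = tvc V E" unfolding is_min_tvc_def by auto
  define C where "C = 9 + 4 * real (card V)"
  define f where "f k = C * sqrt (real k)" for k :: nat
  have f_lim: "(\<lambda>k. f k / real k) \<longlonglongrightarrow> 0"
  proof -
    have "(\<lambda>k. C * inverse (sqrt (real k))) \<longlonglongrightarrow> C * 0"
      by (intro tendsto_intros tendsto_inverse_0_at_top filterlim_compose[OF sqrt_at_top]
          filterlim_real_sequentially)
    moreover have "C * inverse (sqrt (real k)) = f k / real k" for k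
      by (cases "k = 0") (auto simp: f_def field_simps)
    ultimately show ?thesis by simp
  qed
  then have f_o: "f \<in> o(\<lambda>k. real k)"
    by (intro smalloI_tendsto) (auto intro: eventually_mono[OF eventually_gt_at_top[of 0]])
  have protocols: "\<exists>P. solves V E k P \<and> senders V P \<subseteq> S \<and>
      real (cost V P) \<le> (real k / 2 + f k) * real (tvc V E)" if k: "k > 0" for k
  proof -
    obtain d p :: nat where dp: "d > 0" "k + 2 * p + d \<le> 2 * (d * p)"
      "real (d * (p + card V)) \<le> real k / 2 + C * sqrt (real k)"
      using message_length_parameters[OF k, of "card V"] unfolding C_def by blast
    obtain P where P: "solves V E k P" "senders V P \<subseteq> S"
      "cost V P = card S * (d * (p + card V))"
      using tvc_protocol[OF assms tvc(1) dp(2,1)] by blast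
    have "real (cost V P) = real (d * (p + card V)) * real (tvc V E)"
      using P(3) tvc(2) by simp
    also have "\<dots> \<le> (real k / 2 + f k) * real (tvc V E)"
      using dp(3) unfolding f_def by (intro mult_right_mono) auto
    finally show ?thesis using P by blast
  qed
  have opt_le: "real (opt_k V E k) / real k \<le> (1 / 2 + f k / real k) * real (tvc V E)"
    if k: "k > 0" for k
  proof -
    obtain P where P: "solves V E k P" "real (cost V P) \<le> (real k / 2 + f k) * real (tvc V E)"
      using protocols[OF k] by blast
    have "opt_k V E k \<le> cost V P"
      unfolding opt_k_def using P(1) by (intro Least_le) blast
    then have "real (opt_k V E k) / real k \<le> (real k / 2 + f k) * real (tvc V E) / real k"
      using P(2) by (intro divide_right_mono) auto
    then show ?thesis using k by (simp add: field_simps)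
  qed
  have lim: "(\<lambda>k. ereal ((1 / 2 + f k / real k) * real (tvc V E)))
      \<longlonglongrightarrow> ereal ((1 / 2 + 0) * real (tvc V E))"
    by (intro tendsto_intros f_lim)
  have "limsup (\<lambda>k. ereal (real (opt_k V E k) / real k))
      \<le> limsup (\<lambda>k. ereal ((1 / 2 + f k / real k) * real (tvc V E)))"
    \<comment> \<open>The comparison is only needed eventually, which sets aside
      \<open>k = 0\<close>.\<close>
    by (intro Limsup_mono eventually_mono[OF eventually_gt_at_top[of 0]]) (use opt_le in simp)
  also have "\<dots> = ereal (real (tvc V E) / 2)"
    using lim_imp_Limsup[OF _ lim] by simp
  finally show ?thesis using S f_o protocols by blast
qed

end
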